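(* Let $m \ge 1$ and $n \ge 0$ be integers. Let $\sigma$ be a permutation on $P_{m+n+4}$ such that (1) $\sigma(m+2) = m+3$; (2) $\sigma(m+3) = m+4$; (3) $\sigma(s) = m+2$ for some integer $s$ with $1 \le s \le m$; (4) $\sigma(i) \le m$ for all integers $i \ne s$ with $1 \le i \le m+1$; (5) if $n \ge 1$, $\sigma(j) \ge m+5$ for all integers $j \ne t$ with $m+4 \le j \le m+4+n$, where $t$ is the integer in (6); (6) if $n \ge 1$, $\sigma(t) = m+1$ for some integer $t$ with $m+5 \le t \le m+4+n$; (7) if $n = 0$, $\sigma(m+4) = m+1$. Let $\rho$ be the permutation on $P_{m+n+4}$ such that (1) $\rho(m+2) = m+1$; (2) $\rho(m+3) = m+4$; (3) $\rho(s) = m+3$; (4) $\rho(t) = m+2$ if $n \ge 1$; (5) $\rho(m+4) = m+2$ if $n = 0$; (6) $\rho(i) = \sigma(i)$ for all other $i \in P_{m+n+4}$. Then the Petrie matrices of $\sigma$ and $\rho$ are similar.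
   Context: For a positive integer $N$, $P_N = \{1,2,\dots,N\}$. For $N \ge 3$ and a permutation $\sigma$ on $P_N$, the Petrie matrix of $\sigma$ is the $(N-1)\times(N-1)$ matrix $M_{\sigma,N-1} = (a_{i,j})$ with $a_{i,j} = 1$ if $\min\{\sigma(i),\sigma(i+1)\} \le j \le \max\{\sigma(i),\sigma(i+1)\}-1$ and $a_{i,j} = 0$ otherwise. Matrices are considered over $\mathbb{R}$, and similarity means similarity of real matrices. *)

theory Defs
  imports "Jordan_Normal_Form.Matrix" "HOL-Combinatorics.Permutations"
begin

definition petrie_entry :: "(nat \<Rightarrow> nat) \<Rightarrow> nat \<Rightarrow> nat \<Rightarrow> real" where
  "petrie_entry \<sigma> i j =
     (if min (\<sigma> i) (\<sigma> (i + 1)) \<le> j \<and> j \<le> max (\<sigma> i) (\<sigma> (i + 1)) - 1 then 1 else 0)"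

text \<open>
  The entries are indexed from 1, whereas the rows and columns of the type \<open>mat\<close> are
  indexed from 0. The truncated subtraction is harmless for a permutation of
  \<open>{1..N}\<close>, since all values involved are positive.
\<close>
definition petrie_mat :: "nat \<Rightarrow> (nat \<Rightarrow> nat) \<Rightarrow> real mat" where
  "petrie_mat N \<sigma> = mat (N - 1) (N - 1) (\<lambda>(i, j). petrie_entry \<sigma> (i + 1) (j + 1))"

end

theory Submission
  imports Defs
begin

text \<open>
  The permutations \<open>\<sigma>\<close> and \<open>\<rho>\<close> are conjugate: \<open>\<tau> \<circ> \<sigma> = \<rho> \<circ> \<tau>\<close>, where \<open>\<tau>\<close> fixes
  \<open>1, \<dots>, m + 1\<close>, raises \<open>m + 2\<close> and \<open>m + 3\<close> by one, and agrees with \<open>\<rho>\<close> from \<open>m + 3\<close> on.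
  The proof shows that the Petrie matrix \<open>T\<close> of \<open>\<tau>\<close> conjugates the two Petrie matrices.

  If the ones in a Petrie matrix carried the sign of \<open>\<sigma>(i + 1) - \<sigma>(i)\<close>, the matrix would describe
  the action of \<open>\<sigma>\<close> on the differences of consecutive points. Such signed matrices multiply as
  the permutations compose (\<open>sum_signed_entry_comp\<close>). This makes every Petrie matrix invertible
  (\<open>petrie_mat_inverse\<close>), because it differs from the signed one only by the signs of its rows.

  Without signs, conjugacy alone is not enough. Row \<open>i\<close> of \<open>M\<^sub>\<sigma> T\<close> is the sum of the rows \<open>j\<close> of \<open>T\<close>
  with \<open>j\<close> between \<open>\<sigma>(i)\<close> and \<open>\<sigma>(i + 1)\<close>, that is, it counts how often the zigzag path through
  the points \<open>\<tau>(j)\<close> crosses each unit interval. An increasing path crosses every interval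
  between its end points once, so only its end points matter. Now \<open>\<tau>\<close> is increasing on
  \<open>1, \<dots>, m + 3\<close>, and \<open>\<rho>\<close> on \<open>m + 1, m + 2, m + 3\<close>, which settles the rows \<open>i \<le> m + 1\<close> because
  conjugacy makes the end points agree. In the remaining rows the paths for \<open>M\<^sub>\<sigma> T\<close> and \<open>T M\<^sub>\<rho>\<close> pass through the same points
  with indices \<open>\<ge> m + 3\<close>, since \<open>\<tau>\<close> and \<open>\<rho>\<close> agree there; the only difference is how they travel
  from \<open>m + 1\<close> to \<open>m + 4\<close>: under \<open>\<tau>\<close> in two steps, by way of \<open>m + 3\<close>, and under \<open>\<rho>\<close> in one. So
  \<open>M\<^sub>\<sigma> T = T M\<^sub>\<rho>\<close>.
\<close>

section \<open>Products of Petrie matrices\<close>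

lemma permutes_in_interval:
  fixes \<pi> :: "nat \<Rightarrow> nat"
  assumes "\<pi> permutes {1..N}" "1 \<le> i" "i \<le> N"
  shows "1 \<le> \<pi> i" "\<pi> i \<le> N"
  using permutes_in_image[OF assms(1), of i] assms(2,3) by auto

lemma petrie_entry_eq_of_bool:
  assumes "1 \<le> \<pi> i \<or> 1 \<le> \<pi> (i + 1)"
  shows "petrie_entry \<pi> i k
    = of_bool (min (\<pi> i) (\<pi> (i + 1)) \<le> k \<and> k < max (\<pi> i) (\<pi> (i + 1)))"
  using assms by (auto simp: petrie_entry_def)

lemma sum_mult_petrie_entry:
  assumes "\<pi> permutes {1..N}" "1 \<le> i" "i < N"
  shows "(\<Sum>j\<in>{1..<N}. petrie_entry \<pi> i j * f j)
    = sum f {min (\<pi> i) (\<pi> (i + 1))..<max (\<pi> i) (\<pi> (i + 1))}"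
proof -
  let ?I = "{min (\<pi> i) (\<pi> (i + 1))..<max (\<pi> i) (\<pi> (i + 1))}"
  have pos: "1 \<le> \<pi> i" "\<pi> i \<le> N" "1 \<le> \<pi> (i + 1)" "\<pi> (i + 1) \<le> N"
    using permutes_in_interval[OF assms(1)] assms(2,3) by auto
  have "(\<Sum>j\<in>{1..<N}. petrie_entry \<pi> i j * f j) = (\<Sum>j\<in>{1..<N}. if j \<in> ?I then f j else 0)"
    by (rule sum.cong) (use pos in \<open>auto simp: petrie_entry_eq_of_bool\<close>)
  also have "\<dots> = sum f ({1..<N} \<inter> ?I)"
    by (rule sum.inter_restrict[symmetric]) simp
  also have "{1..<N} \<inter> ?I = ?I"
    using pos by auto
  finally show ?thesis .
qed

lemma sum_matrix_index_shift:
  "(\<Sum>j\<in>{0..<N - 1}. f (j + 1)) = (\<Sum>j\<in>{1..<N}. f j)" for N :: nat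
proof (cases N)
  case (Suc M)
  then show ?thesis
    using sum.shift_bounds_Suc_ivl[of f 0 M] by simp
qed simp

lemma index_mult_petrie_mat:
  assumes "\<pi> permutes {1..N}" "i < N - 1" "k < N - 1"
  shows "(petrie_mat N \<pi> * petrie_mat N \<pi>') $$ (i, k)
    = (\<Sum>j\<in>{min (\<pi> (i + 1)) (\<pi> (i + 2))..<max (\<pi> (i + 1)) (\<pi> (i + 2))}.
         petrie_entry \<pi>' j (k + 1))"
proof -
  have "(petrie_mat N \<pi> * petrie_mat N \<pi>') $$ (i, k)
      = (\<Sum>j\<in>{0..<N - 1}. petrie_entry \<pi> (i + 1) (j + 1) * petrie_entry \<pi>' (j + 1) (k + 1))"
    using assms(2,3) by (simp add: petrie_mat_def scalar_prod_def)
  also have "\<dots> = (\<Sum>j\<in>{1..<N}. petrie_entry \<pi> (i + 1) j * petrie_entry \<pi>' j (k + 1))"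
    by (rule sum_matrix_index_shift)
  also have "\<dots> = (\<Sum>j\<in>{min (\<pi> (i + 1)) (\<pi> (i + 1 + 1))..<max (\<pi> (i + 1)) (\<pi> (i + 1 + 1))}.
         petrie_entry \<pi>' j (k + 1))"
    by (rule sum_mult_petrie_entry[OF assms(1)]) (use assms(2) in auto)
  finally show ?thesis
    by (simp add: numeral_2_eq_2)
qed

text \<open>
  A path that only moves up crosses each interval between its end points exactly once.
\<close>
lemma sum_petrie_entry_mono:
  assumes "a \<le> b" "\<And>j. a \<le> j \<Longrightarrow> j < b \<Longrightarrow> 1 \<le> \<pi> j \<and> \<pi> j \<le> \<pi> (j + 1)"
  shows "(\<Sum>j\<in>{a..<b}. petrie_entry \<pi> j k) = of_bool (\<pi> a \<le> k \<and> k < \<pi> b)"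
proof -
  have "\<pi> a \<le> \<pi> b \<and> ?thesis"
    using assms
  proof (induction b rule: dec_induct)
    case base
    then show ?case by simp
  next
    case (step b)
    then have IH: "\<pi> a \<le> \<pi> b"
        "(\<Sum>j\<in>{a..<b}. petrie_entry \<pi> j k) = of_bool (\<pi> a \<le> k \<and> k < \<pi> b)"
      and up: "1 \<le> \<pi> b" "\<pi> b \<le> \<pi> (b + 1)"
      by auto
    have "petrie_entry \<pi> b k = of_bool (\<pi> b \<le> k \<and> k < \<pi> (b + 1))"
      using up by (auto simp: petrie_entry_eq_of_bool)
    with IH up step.hyps show ?case
      by (auto simp: of_bool_def)
  qed
  then show ?thesis ..
qed

text \<open>
  Unsigned Petrie matrices do not multiply as permutations compose, since a path that turns back
  crosses some interval twice. This is the case in which a row of the product is still right.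
\<close>
lemma sum_petrie_entry_comp_mono:
  assumes "\<And>j. min (\<pi> i) (\<pi> (i + 1)) \<le> j \<Longrightarrow> j < max (\<pi> i) (\<pi> (i + 1)) \<Longrightarrow>
                 1 \<le> \<pi>' j \<and> \<pi>' j \<le> \<pi>' (j + 1)"
    and "\<pi>' (\<pi> i) \<noteq> \<pi>' (\<pi> (i + 1))"
  shows "(\<Sum>j\<in>{min (\<pi> i) (\<pi> (i + 1))..<max (\<pi> i) (\<pi> (i + 1))}. petrie_entry \<pi>' j k)
    = petrie_entry (\<pi>' \<circ> \<pi>) i k"
proof -
  let ?a = "min (\<pi> i) (\<pi> (i + 1))" and ?b = "max (\<pi> i) (\<pi> (i + 1))"
  have sum: "(\<Sum>j\<in>{?a..<?b}. petrie_entry \<pi>' j k) = of_bool (\<pi>' ?a \<le> k \<and> k < \<pi>' ?b)"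
    by (rule sum_petrie_entry_mono) (use assms(1) in auto)
  have "\<pi>' j \<ge> \<pi>' ?a" if "?a \<le> j" "j \<le> ?b" for j
    using that
  proof (induction j rule: dec_induct)
    case (step j)
    then show ?case using assms(1)[of j] by simp
  qed simp
  then have le: "\<pi>' ?a \<le> \<pi>' ?b" by simp
  have ends: "min (\<pi>' (\<pi> i)) (\<pi>' (\<pi> (i + 1))) = \<pi>' ?a" "max (\<pi>' (\<pi> i)) (\<pi>' (\<pi> (i + 1))) = \<pi>' ?b"
    using le by (cases "\<pi> i \<le> \<pi> (i + 1)"; simp add: min_def max_def)+
  have "1 \<le> (\<pi>' \<circ> \<pi>) i \<or> 1 \<le> (\<pi>' \<circ> \<pi>) (i + 1)"
    using assms(2) by (simp; linarith)
  from petrie_entry_eq_of_bool[of "\<pi>' \<circ> \<pi>", OF this] show ?thesis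
    unfolding sum comp_def ends by simp
qed

section \<open>Invertibility of Petrie matrices\<close>

definition signed_entry :: "(nat \<Rightarrow> nat) \<Rightarrow> nat \<Rightarrow> nat \<Rightarrow> real" where
  "signed_entry \<pi> i k = of_bool (\<pi> i \<le> k) - of_bool (\<pi> (i + 1) \<le> k)"

definition row_sign :: "(nat \<Rightarrow> nat) \<Rightarrow> nat \<Rightarrow> real" where
  "row_sign \<pi> i = (if \<pi> i < \<pi> (i + 1) then 1 else - 1)"

lemma row_sign_mult_self: "row_sign \<pi> i * row_sign \<pi> i = 1"
  by (simp add: row_sign_def)

lemma petrie_entry_eq_signed_entry:
  assumes "1 \<le> \<pi> i \<or> 1 \<le> \<pi> (i + 1)"
  shows "petrie_entry \<pi> i k = row_sign \<pi> i * signed_entry \<pi> i k"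
  using assms by (auto simp: petrie_entry_eq_of_bool signed_entry_def row_sign_def)

lemma sum_tail_telescope:
  fixes f :: "nat \<Rightarrow> real"
  assumes "1 \<le> p" "p \<le> N"
  shows "(\<Sum>k\<in>{1..<N}. of_bool (p \<le> k) * (f k - f (k + 1))) = f p - f N"
proof -
  have "(\<Sum>k\<in>{1..<N}. of_bool (p \<le> k) * (f k - f (k + 1))) = (\<Sum>k\<in>{p..<N}. f k - f (k + 1))"
    by (rule sum.mono_neutral_cong_right) (use assms in auto)
  also have "\<dots> = - (\<Sum>k\<in>{p..<N}. f (Suc k) - f k)"
    by (simp add: sum_negf[symmetric])
  also have "\<dots> = f p - f N"
    using sum_Suc_diff'[OF assms(2), of f] by simp
  finally show ?thesis .
qed

text \<open>
  The reason is summation by parts: the tail sums of column \<open>l\<close> for \<open>\<pi>'\<close> telescope, and the common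
  boundary term at \<open>N\<close> cancels in the difference.
\<close>
lemma sum_signed_entry_comp:
  assumes "1 \<le> \<pi> i" "\<pi> i \<le> N" "1 \<le> \<pi> (i + 1)" "\<pi> (i + 1) \<le> N"
  shows "(\<Sum>k\<in>{1..<N}. signed_entry \<pi> i k * signed_entry \<pi>' k l) = signed_entry (\<pi>' \<circ> \<pi>) i l"
proof -
  let ?f = "\<lambda>k. of_bool (\<pi>' k \<le> l) :: real"
  have "(\<Sum>k\<in>{1..<N}. signed_entry \<pi> i k * signed_entry \<pi>' k l)
      = (\<Sum>k\<in>{1..<N}. of_bool (\<pi> i \<le> k) * (?f k - ?f (k + 1)))
        - (\<Sum>k\<in>{1..<N}. of_bool (\<pi> (i + 1) \<le> k) * (?f k - ?f (k + 1)))"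
    unfolding signed_entry_def by (simp only: left_diff_distrib sum_subtractf)
  also have "\<dots> = ?f (\<pi> i) - ?f (\<pi> (i + 1))"
    unfolding sum_tail_telescope[OF assms(1,2), of ?f] sum_tail_telescope[OF assms(3,4), of ?f]
    by simp
  finally show ?thesis
    by (simp add: signed_entry_def)
qed

lemma signed_entry_id: "signed_entry id i l = of_bool (i = l)"
  by (auto simp: signed_entry_def)

text \<open>
  The Petrie matrix factors as a diagonal matrix of signs times the signed matrix of \<open>\<pi>\<close>. The
  diagonal factor is its own inverse, and the signed factor is inverted by that of \<open>\<pi>\<inverse>\<close>.
\<close>
lemma petrie_mat_inverse:
  assumes "\<pi> permutes {1..N}"
  obtains B where "B \<in> carrier_mat (N - 1) (N - 1)"
    "petrie_mat N \<pi> * B = 1\<^sub>m (N - 1)" "B * petrie_mat N \<pi> = 1\<^sub>m (N - 1)"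
proof
  let ?b = "\<lambda>k l. signed_entry (inv_into UNIV \<pi>) k l * row_sign \<pi> l"
  let ?B = "mat (N - 1) (N - 1) (\<lambda>(k, l). ?b (k + 1) (l + 1))"
  note inv = permutes_inv[OF assms]
  note range = permutes_in_interval[OF assms]
  note inv_range = permutes_in_interval[OF inv]
  have entry: "petrie_entry \<pi> i k = row_sign \<pi> i * signed_entry \<pi> i k" if "1 \<le> i" "i < N" for i k
    using petrie_entry_eq_signed_entry range(1)[of i] that by simp
  have right: "(\<Sum>k\<in>{1..<N}. petrie_entry \<pi> i k * ?b k l) = of_bool (i = l)"
    if "1 \<le> i" "i < N" for i l
  proof -
    have "(\<Sum>k\<in>{1..<N}. petrie_entry \<pi> i k * ?b k l)
        = row_sign \<pi> i * row_sign \<pi> l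
          * (\<Sum>k\<in>{1..<N}. signed_entry \<pi> i k * signed_entry (inv_into UNIV \<pi>) k l)"
      unfolding entry[OF that] sum_distrib_left by (simp only: mult_ac)
    also have "\<dots> = row_sign \<pi> i * row_sign \<pi> l * of_bool (i = l)"
      by (subst sum_signed_entry_comp)
         (use range[of i] range[of "i + 1"] that in
           \<open>auto simp: permutes_inv_o(2)[OF assms] signed_entry_id\<close>)
    finally show ?thesis
      by (simp add: row_sign_mult_self)
  qed
  have left: "(\<Sum>k\<in>{1..<N}. ?b i k * petrie_entry \<pi> k l) = of_bool (i = l)"
    if "1 \<le> i" "i < N" for i l
  proof -
    have "?b i k * petrie_entry \<pi> k l = signed_entry (inv_into UNIV \<pi>) i k * signed_entry \<pi> k l"
      if "k \<in> {1..<N}" for k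
    proof -
      have "?b i k * petrie_entry \<pi> k l
          = (row_sign \<pi> k * row_sign \<pi> k) * (signed_entry (inv_into UNIV \<pi>) i k * signed_entry \<pi> k l)"
        using that by (simp add: entry)
      then show ?thesis
        by (simp add: row_sign_mult_self)
    qed
    then have "(\<Sum>k\<in>{1..<N}. ?b i k * petrie_entry \<pi> k l)
        = (\<Sum>k\<in>{1..<N}. signed_entry (inv_into UNIV \<pi>) i k * signed_entry \<pi> k l)"
      by (rule sum.cong[OF refl])
    also have "\<dots> = of_bool (i = l)"
      by (subst sum_signed_entry_comp)
         (use inv_range[of i] inv_range[of "i + 1"] that in
           \<open>auto simp: permutes_inv_o(1)[OF assms] signed_entry_id\<close>)
    finally show ?thesis .
  qed
  show "?B \<in> carrier_mat (N - 1) (N - 1)" by simp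
  show "petrie_mat N \<pi> * ?B = 1\<^sub>m (N - 1)"
  proof (rule eq_matI)
    fix i l assume "i < dim_row (1\<^sub>m (N - 1))" "l < dim_col (1\<^sub>m (N - 1))"
    then have il: "i < N - 1" "l < N - 1" by auto
    then have "(petrie_mat N \<pi> * ?B) $$ (i, l)
        = (\<Sum>k\<in>{0..<N - 1}. petrie_entry \<pi> (i + 1) (k + 1) * ?b (k + 1) (l + 1))"
      by (simp add: petrie_mat_def scalar_prod_def)
    also have "\<dots> = (\<Sum>k\<in>{1..<N}. petrie_entry \<pi> (i + 1) k * ?b k (l + 1))"
      by (rule sum_matrix_index_shift)
    also have "\<dots> = of_bool (i + 1 = l + 1)"
      by (rule right) (use il in auto)
    finally show "(petrie_mat N \<pi> * ?B) $$ (i, l) = 1\<^sub>m (N - 1) $$ (i, l)"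
      using il by simp
  qed (auto simp: petrie_mat_def)
  show "?B * petrie_mat N \<pi> = 1\<^sub>m (N - 1)"
  proof (rule eq_matI)
    fix i l assume "i < dim_row (1\<^sub>m (N - 1))" "l < dim_col (1\<^sub>m (N - 1))"
    then have il: "i < N - 1" "l < N - 1" by auto
    then have "(?B * petrie_mat N \<pi>) $$ (i, l)
        = (\<Sum>k\<in>{0..<N - 1}. ?b (i + 1) (k + 1) * petrie_entry \<pi> (k + 1) (l + 1))"
      by (simp add: petrie_mat_def scalar_prod_def)
    also have "\<dots> = (\<Sum>k\<in>{1..<N}. ?b (i + 1) k * petrie_entry \<pi> k (l + 1))"
      by (rule sum_matrix_index_shift)
    also have "\<dots> = of_bool (i + 1 = l + 1)"
      by (rule left) (use il in auto)
    finally show "(?B * petrie_mat N \<pi>) $$ (i, l) = 1\<^sub>m (N - 1) $$ (i, l)"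
      using il by simp
  qed (auto simp: petrie_mat_def)
qed

text \<open>
  Comparing \<open>M\<^sub>\<sigma> T\<close> with \<open>T M\<^sub>\<rho>\<close> row by row turns the similarity into an equality of crossing counts
  of paths.
\<close>
lemma similar_petrie_matI:
  assumes "\<sigma> permutes {1..N}" "\<tau> permutes {1..N}"
    and rows: "\<And>i k. 1 \<le> i \<Longrightarrow> i < N \<Longrightarrow>
      (\<Sum>j\<in>{min (\<sigma> i) (\<sigma> (i + 1))..<max (\<sigma> i) (\<sigma> (i + 1))}. petrie_entry \<tau> j k)
      = (\<Sum>j\<in>{min (\<tau> i) (\<tau> (i + 1))..<max (\<tau> i) (\<tau> (i + 1))}. petrie_entry \<rho> j k)"
  shows "similar_mat (petrie_mat N \<sigma>) (petrie_mat N \<rho>)"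
proof -
  let ?S = "petrie_mat N \<sigma>" and ?R = "petrie_mat N \<rho>" and ?T = "petrie_mat N \<tau>"
  obtain B where B: "B \<in> carrier_mat (N - 1) (N - 1)"
    "?T * B = 1\<^sub>m (N - 1)" "B * ?T = 1\<^sub>m (N - 1)"
    using petrie_mat_inverse[OF assms(2)] .
  have carrier: "petrie_mat N \<pi> \<in> carrier_mat (N - 1) (N - 1)" for \<pi>
    by (simp add: petrie_mat_def)
  have dims: "dim_row (petrie_mat N \<pi>) = N - 1" "dim_col (petrie_mat N \<pi>) = N - 1" for \<pi>
    using carrier[of \<pi>] by auto
  have intertwine: "?S * ?T = ?T * ?R"
  proof (rule eq_matI)
    fix i k assume "i < dim_row (?T * ?R)" "k < dim_col (?T * ?R)"
    then have ik: "i < N - 1" "k < N - 1" by (auto simp: dims)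
    then show "(?S * ?T) $$ (i, k) = (?T * ?R) $$ (i, k)"
      using rows[of "i + 1" "k + 1"]
      by (simp add: index_mult_petrie_mat[OF assms(1) ik] index_mult_petrie_mat[OF assms(2) ik]
          numeral_2_eq_2)
  qed (auto simp: dims)
  have "?S = ?S * (?T * B)"
    by (simp only: B(2) right_mult_one_mat[OF carrier])
  also have "\<dots> = ?T * ?R * B"
    using assoc_mult_mat[OF carrier carrier B(1)] intertwine by metis
  finally have "similar_mat_wit ?S ?R ?T B"
    by (intro similar_mat_witI[of _ _ "N - 1"] B carrier)
  then show ?thesis
    by (auto simp: similar_mat_def)
qed

section \<open>The similarity\<close>

theorem theorem7:
  fixes m n s t :: nat and \<sigma> \<rho> :: "nat \<Rightarrow> nat"
  assumes "m \<ge> 1"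
    and "\<sigma> permutes {1..m + n + 4}"
    and "\<sigma> (m + 2) = m + 3"
    and "\<sigma> (m + 3) = m + 4"
    and "1 \<le> s" and "s \<le> m" and "\<sigma> s = m + 2"
    and "\<And>i. 1 \<le> i \<Longrightarrow> i \<le> m + 1 \<Longrightarrow> i \<noteq> s \<Longrightarrow> \<sigma> i \<le> m"
    and "\<And>j. n \<ge> 1 \<Longrightarrow> m + 4 \<le> j \<Longrightarrow> j \<le> m + 4 + n \<Longrightarrow> j \<noteq> t \<Longrightarrow> \<sigma> j \<ge> m + 5"
    and "n \<ge> 1 \<Longrightarrow> m + 5 \<le> t \<and> t \<le> m + 4 + n \<and> \<sigma> t = m + 1"
    and "n = 0 \<Longrightarrow> \<sigma> (m + 4) = m + 1"
    and "\<rho> permutes {1..m + n + 4}"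
    and "\<rho> (m + 2) = m + 1"
    and "\<rho> (m + 3) = m + 4"
    and "\<rho> s = m + 3"
    and "n \<ge> 1 \<Longrightarrow> \<rho> t = m + 2"
    and "n = 0 \<Longrightarrow> \<rho> (m + 4) = m + 2"
    and "\<And>i. i \<in> {1..m + n + 4} \<Longrightarrow>
           i \<notin> {m + 2, m + 3, s, if n \<ge> 1 then t else m + 4} \<Longrightarrow> \<rho> i = \<sigma> i"
  shows "similar_mat (petrie_mat (m + n + 4) \<sigma>) (petrie_mat (m + n + 4) \<rho>)"
proof -
  define N where "N = m + n + 4"
  \<comment> \<open>For \<open>n = 0\<close> the point \<open>m + 4\<close> takes over the part that \<open>t\<close> plays for \<open>n \<ge> 1\<close>.\<close>
  define u where "u = (if n \<ge> 1 then t else m + 4)"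
  define \<tau> where "\<tau> i = (if i \<le> m + 1 then i else if i \<le> m + 3 then i + 1 else \<rho> i)" for i
  have \<sigma>: "\<sigma> permutes {1..N}" and \<rho>: "\<rho> permutes {1..N}"
    using assms(2,12) by (simp_all add: N_def)
  have \<sigma>_mid: "\<sigma> (m + 2) = m + 3" "\<sigma> (m + 3) = m + 4" "\<sigma> s = m + 2"
    using assms(3,4,7) by auto
  have \<rho>_mid: "\<rho> (m + 2) = m + 1" "\<rho> (m + 3) = m + 4" "\<rho> s = m + 3"
    using assms(13-15) by auto
  have s: "1 \<le> s" "s \<le> m" using assms(5,6) by auto
  have u: "m + 4 \<le> u" "u \<le> N" "\<sigma> u = m + 1" "\<rho> u = m + 2"
    using assms(10,11,16,17) by (auto simp: u_def N_def)
  have same: "\<rho> i = \<sigma> i" if "1 \<le> i" "i \<le> N" "i \<noteq> m + 2" "i \<noteq> m + 3" "i \<noteq> s" "i \<noteq> u" for i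
    using assms(18)[of i] that unfolding N_def u_def by simp
  have left: "1 \<le> \<sigma> i" "\<sigma> i \<le> m" "\<rho> i = \<sigma> i" if "1 \<le> i" "i \<le> m + 1" "i \<noteq> s" for i
    using assms(8)[of i] permutes_in_interval(1)[OF \<sigma>, of i] same[of i] that u(1)
    by (auto simp: N_def)
  have right: "m + 5 \<le> \<sigma> j" "\<sigma> j \<le> N" "\<rho> j = \<sigma> j" if "m + 4 \<le> j" "j \<le> N" "j \<noteq> u" for j
  proof -
    have "n \<ge> 1" using that by (auto simp: N_def u_def split: if_splits)
    then show "m + 5 \<le> \<sigma> j"
      using assms(9)[of j] that by (simp add: N_def u_def)
    show "\<sigma> j \<le> N" using permutes_in_interval(2)[OF \<sigma>, of j] that by simp
    show "\<rho> j = \<sigma> j" using same[of j] that s by simp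
  qed
  have \<tau>_right: "\<tau> j = \<rho> j" if "m + 3 \<le> j" for j
    using that \<rho>_mid by (cases "j = m + 3") (auto simp: \<tau>_def)
  have \<tau>_mid: "\<tau> (m + 1) = m + 1" "\<tau> (m + 2) = m + 3" "\<tau> (m + 3) = m + 4"
    by (simp_all add: \<tau>_def)

  have \<tau>: "\<tau> permutes {1..N}"
  proof (rule bij_imp_permutes)
    have into: "\<tau> ` {1..N} \<subseteq> {1..N}"
      using permutes_in_interval[OF \<rho>] by (auto simp: \<tau>_def N_def)
    \<comment> \<open>On \<open>m + 4, \<dots>, N\<close> the map \<open>\<tau>\<close> takes only values that it does not take before.\<close>
    have avoid: "\<rho> j = m + 2 \<or> m + 5 \<le> \<rho> j" if "m + 4 \<le> j" "j \<le> N" for j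
      using u(4) right[of j] that by (cases "j = u") auto
    have "inj_on \<tau> {1..N}"
    proof (rule inj_onI)
      fix x y assume xy: "x \<in> {1..N}" "y \<in> {1..N}" "\<tau> x = \<tau> y"
      show "x = y"
        using xy avoid[of x] avoid[of y] injD[OF permutes_inj[OF \<rho>], of x y]
        by (auto simp: \<tau>_def split: if_splits)
    qed
    then show "bij_betw \<tau> {1..N} {1..N}"
      using into by (simp add: bij_betw_def endo_inj_surj)
    show "\<tau> x = x" if "x \<notin> {1..N}" for x
      using that permutes_not_in[OF \<rho> that] by (auto simp: \<tau>_def N_def)
  qed
  have up: "1 \<le> \<tau> j \<and> \<tau> j \<le> \<tau> (j + 1)" if "1 \<le> j" "j < m + 3" for j
    using that by (auto simp: \<tau>_def)

  have "similar_mat (petrie_mat N \<sigma>) (petrie_mat N \<rho>)"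
  proof (rule similar_petrie_matI[OF \<sigma> \<tau>])
    fix i k :: nat
    assume i: "1 \<le> i" "i < N"
    let ?path = "\<lambda>\<pi> a b. \<Sum>j\<in>{min a b..<max a b}. petrie_entry \<pi> j k"
    have distinct: "\<tau> (\<sigma> i) \<noteq> \<tau> (\<sigma> (i + 1))"
      by (simp add: inj_eq[OF permutes_inj[OF \<sigma>]] inj_eq[OF permutes_inj[OF \<tau>]])
    consider "i \<le> m" | "i = m + 1" | "i = m + 2" | "m + 3 \<le> i" by linarith
    then show "?path \<tau> (\<sigma> i) (\<sigma> (i + 1)) = ?path \<rho> (\<tau> i) (\<tau> (i + 1))"
    proof cases
      case 1
      have comp: "1 \<le> \<sigma> j \<and> \<sigma> j \<le> m + 2 \<and> \<tau> (\<sigma> j) = \<rho> j" if "1 \<le> j" "j \<le> m + 1" for j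
        using left[of j] that \<sigma>_mid \<rho>_mid by (cases "j = s") (auto simp: \<tau>_def)
      have "?path \<tau> (\<sigma> i) (\<sigma> (i + 1)) = petrie_entry (\<tau> \<circ> \<sigma>) i k"
        by (rule sum_petrie_entry_comp_mono)
           (use up comp[of i] comp[of "i + 1"] i 1 distinct in auto)
      also have "\<dots> = petrie_entry \<rho> i k"
        using comp[of i] comp[of "i + 1"] i 1 by (simp add: petrie_entry_def)
      finally show ?thesis using 1 by (simp add: \<tau>_def)
    next
      case 2
      let ?a = "\<sigma> (m + 1)"
      have a: "1 \<le> ?a" "?a \<le> m" "\<rho> (m + 1) = ?a"
        using left[of "m + 1"] s by auto
      have "?path \<tau> (\<sigma> i) (\<sigma> (i + 1)) = (\<Sum>j\<in>{?a..<m + 3}. petrie_entry \<tau> j k)"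
        using 2 a \<sigma>_mid by simp
      also have "\<dots> = of_bool (\<tau> ?a \<le> k \<and> k < \<tau> (m + 3))"
        by (rule sum_petrie_entry_mono) (use a up in auto)
      also have "\<dots> = of_bool (\<rho> (m + 1) \<le> k \<and> k < \<rho> (m + 3))"
        using a(2) by (simp only: a(3) \<tau>_mid \<rho>_mid) (simp add: \<tau>_def)
      also have "\<dots> = (\<Sum>j\<in>{m + 1..<m + 3}. petrie_entry \<rho> j k)"
      proof (rule sum_petrie_entry_mono[symmetric])
        fix j assume "m + 1 \<le> j" "j < m + 3"
        then have "j = m + 1 \<or> j = m + 2" by linarith
        then show "1 \<le> \<rho> j \<and> \<rho> j \<le> \<rho> (j + 1)"
          using a \<rho>_mid by (auto simp: numeral_eq_Suc)
      qed simp
      finally show ?thesis using 2 \<tau>_mid by simp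
    next
      case 3
      have "petrie_entry \<tau> (m + 3) k = petrie_entry \<rho> (m + 3) k"
        by (simp add: petrie_entry_def \<tau>_right)
      then show ?thesis using 3 \<sigma>_mid \<tau>_mid by (simp add: numeral_eq_Suc)
    next
      case 4
      have tail: "(\<Sum>j\<in>{a..<b}. petrie_entry \<tau> j k) = (\<Sum>j\<in>{a..<b}. petrie_entry \<rho> j k)"
        if "m + 3 \<le> a" for a b
        by (rule sum.cong) (use that in \<open>auto simp: petrie_entry_def \<tau>_right\<close>)
      \<comment> \<open>Both paths lead from \<open>m + 1\<close> to \<open>\<rho> z\<close>, and both pass \<open>m + 4\<close>.\<close>
      have detour: "(\<Sum>j\<in>{m + 1..<z}. petrie_entry \<tau> j k) = (\<Sum>j\<in>{m + 2..<z}. petrie_entry \<rho> j k)"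
        if "m + 4 \<le> z" for z
      proof -
        have "(\<Sum>j\<in>{m + 1..<m + 3}. petrie_entry \<tau> j k) = of_bool (m + 1 \<le> k \<and> k < m + 4)"
          using sum_petrie_entry_mono[of "m + 1" "m + 3" \<tau> k] up \<tau>_mid by simp
        moreover have "(\<Sum>j\<in>{m + 2..<m + 3}. petrie_entry \<rho> j k) = of_bool (m + 1 \<le> k \<and> k < m + 4)"
          using \<rho>_mid petrie_entry_eq_of_bool[of \<rho> "m + 2" k] by (simp add: numeral_eq_Suc)
        ultimately show ?thesis
          using sum.atLeastLessThan_concat[of "m + 1" "m + 3" z "\<lambda>j. petrie_entry \<tau> j k"]
            sum.atLeastLessThan_concat[of "m + 2" "m + 3" z "\<lambda>j. petrie_entry \<rho> j k"]
            tail[of "m + 3" z] that by simp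
      qed
      have far: "m + 4 \<le> \<sigma> j \<and> \<rho> j = \<sigma> j" if "m + 3 \<le> j" "j \<le> N" "j \<noteq> u" for j
        using right[of j] that \<sigma>_mid \<rho>_mid by (cases "j = m + 3") auto
      have "?path \<tau> (\<sigma> i) (\<sigma> (i + 1)) = ?path \<rho> (\<rho> i) (\<rho> (i + 1))"
      proof -
        consider "i = u" | "i + 1 = u" | "i \<noteq> u" "i + 1 \<noteq> u" by blast
        then show ?thesis
        proof cases
          case 1
          then show ?thesis using far[of "i + 1"] detour[of "\<sigma> (i + 1)"] u i 4 by simp
        next
          case 2
          then show ?thesis using far[of i] detour[of "\<sigma> i"] u i 4 by simp
        next
          case 3
          then show ?thesis using far[of i] far[of "i + 1"] i 4 by (simp add: tail)
        qed
      qed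
      then show ?thesis using 4 by (simp add: \<tau>_right)
    qed
  qed
  then show ?thesis by (simp add: N_def)
qed

end
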